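(* Let $T$ be a tournament on 8 vertices such that there are four vertices of $T$ whose outdegrees (in $T$) sum to $8$. Then $T$ is not intrinsically linked as a directed graph.
   Context: A tournament is a directed graph with exactly one directed edge between each pair of distinct vertices. A cycle in a directed graph is consistently oriented if it is a directed cycle. A directed graph $G$ is intrinsically linked as a directed graph if every (tame) embedding of $G$ into $S^3$ contains two vertex-disjoint consistently oriented cycles that form a non-split link. *)

theory Defs
  imports "HOL-Analysis.Analysis" "Graph_Theory.Graph_Theory"
begin

definition tournament :: "('a, 'b) pre_digraph \<Rightarrow> bool" where
  "tournament G \<longleftrightarrow> fin_digraph G \<and> loopfree_digraph G \<and>
     (\<forall>u\<in>verts G. \<forall>v\<in>verts G. u \<noteq> v \<longrightarrow>
        (\<exists>!e. e \<in> arcs G \<and> {tail G e, head G e} = {u, v}))"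

abbreviation S3 :: "(real ^ 4) set" where
  "S3 \<equiv> sphere 0 1"

text \<open>
  An embedding of a finite digraph in the 3-sphere: \<open>f\<close> places the vertices and \<open>\<gamma> e\<close> runs along
  the edge \<open>e\<close> from its tail to its head. Since \<open>f\<close> is injective on the vertices, the simple path
  \<open>\<gamma> e\<close> is an arc unless \<open>e\<close> is a loop. The last two conditions say that edges meet only in
  common end vertices.
\<close>
definition embedding_S3 ::
    "('a, 'b) pre_digraph \<Rightarrow> ('a \<Rightarrow> real ^ 4) \<Rightarrow> ('b \<Rightarrow> real \<Rightarrow> real ^ 4) \<Rightarrow> bool" where
  "embedding_S3 G f \<gamma> \<longleftrightarrow>
     f ` verts G \<subseteq> S3 \<and> inj_on f (verts G) \<and>
     (\<forall>e\<in>arcs G. simple_path (\<gamma> e) \<and> path_image (\<gamma> e) \<subseteq> S3 \<and>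
        pathstart (\<gamma> e) = f (tail G e) \<and> pathfinish (\<gamma> e) = f (head G e) \<and>
        path_image (\<gamma> e) \<inter> f ` verts G \<subseteq> {f (tail G e), f (head G e)}) \<and>
     (\<forall>e\<in>arcs G. \<forall>e'\<in>arcs G. e \<noteq> e' \<longrightarrow>
        path_image (\<gamma> e) \<inter> path_image (\<gamma> e') \<subseteq> f ` verts G)"

definition polygonal :: "'a::real_vector set \<Rightarrow> bool" where
  "polygonal X \<longleftrightarrow> (\<exists>F. finite F \<and> X = (\<Union>(a, b)\<in>F. closed_segment a b))"

text \<open>
  Tame means equivalent to a polygonal embedding under a homeomorphism of the 3-sphere. Polygonality
  is read off in the complement of a point \<open>p\<close> missed by the graph; the homeomorphisms from this
  complement onto \<open>\<real>\<^sup>3\<close> are exactly the stereographic projections composed with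
  self-homeomorphisms of the 3-sphere.
\<close>
definition tame_embedding_S3 ::
    "('a, 'b) pre_digraph \<Rightarrow> ('a \<Rightarrow> real ^ 4) \<Rightarrow> ('b \<Rightarrow> real \<Rightarrow> real ^ 4) \<Rightarrow> bool" where
  "tame_embedding_S3 G f \<gamma> \<longleftrightarrow> embedding_S3 G f \<gamma> \<and>
     (\<exists>p h k. p \<in> S3 \<and> p \<notin> f ` verts G \<and> (\<forall>e\<in>arcs G. p \<notin> path_image (\<gamma> e)) \<and>
        homeomorphism (S3 - {p}) (UNIV :: (real ^ 3) set) h k \<and>
        (\<forall>e\<in>arcs G. polygonal (h ` path_image (\<gamma> e))))"

text \<open>
  The two-component link with components \<open>K\<close> and \<open>L\<close> is split if some embedded 2-sphere in its
  complement separates \<open>K\<close> from \<open>L\<close>. No tameness is demanded of the 2-sphere: by Bing's approximation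
  theorem a separating 2-sphere can always be replaced by a tame one.
\<close>
definition split_link :: "(real ^ 4) set \<Rightarrow> (real ^ 4) set \<Rightarrow> bool" where
  "split_link K L \<longleftrightarrow>
     (\<exists>S. S \<subseteq> S3 - (K \<union> L) \<and> S homeomorphic sphere (0 :: real ^ 3) 1 \<and>
        (\<exists>C\<in>components (S3 - S). \<exists>D\<in>components (S3 - S). C \<noteq> D \<and> K \<subseteq> C \<and> L \<subseteq> D))"

definition cycle_image :: "('b \<Rightarrow> real \<Rightarrow> real ^ 4) \<Rightarrow> 'b list \<Rightarrow> (real ^ 4) set" where
  "cycle_image \<gamma> c = (\<Union>e\<in>set c. path_image (\<gamma> e))"

text \<open>
  A \<open>cycle\<close> of \<^theory>\<open>Graph_Theory.Arc_Walk\<close> follows the direction of the edges, so it is a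
  consistently oriented cycle; its vertices are the tails of its edges.
\<close>
definition intrinsically_linked_digraph :: "('a, 'b) pre_digraph \<Rightarrow> bool" where
  "intrinsically_linked_digraph G \<longleftrightarrow>
     (\<forall>f \<gamma>. tame_embedding_S3 G f \<gamma> \<longrightarrow>
        (\<exists>c d. pre_digraph.cycle G c \<and> pre_digraph.cycle G d \<and>
           tail G ` set c \<inter> tail G ` set d = {} \<and>
           \<not> split_link (cycle_image \<gamma> c) (cycle_image \<gamma> d)))"

end

theory Submission
  imports Defs
begin

text \<open>
  Let \<open>U\<close> be the given set of four vertices. Six of the eight arcs that start in \<open>U\<close> also end
  in \<open>U\<close>, so just two arcs leave \<open>U\<close>, say \<open>a1 \<rightarrow> b1\<close> and
  \<open>a2 \<rightarrow> b2\<close>. A directed cycle with vertices inside and outside \<open>U\<close> has to use one of them.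
  This makes it possible to draw the tournament in 3-space with straight edges such that any two vertex-disjoint
  directed cycles are weakly separated by a plane: one lies in one closed half-space, the other in the opposite one.
  Both may have edges in the plane.

  Weak separation is enough (\<open>split_link_of_weakly_separating_plane\<close>): the parts of two disjoint compact
  sets in the plane are disjoint, and a small shear along the normal, by a function on the plane that is positive on one
  part and negative on the other, makes the separation strict. Then a large ball contains one set and misses the other,
  and its boundary is the required 2-sphere. A homeomorphism from \<open>\<real>\<^sup>3\<close> to the 3-sphere without
  a point takes everything to the 3-sphere.

  The drawing (\<open>corner\<close>) is arranged so that three planes suffice. All of \<open>U\<close> lies in a plane
  with the rest of the drawing below it; this plane separates a cycle inside \<open>U\<close> from anything else. A
  parallel plane below \<open>U\<close> contains three of the other four vertices, and the fourth one, \<open>v\<close>,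
  lies below it; it separates a cycle outside \<open>U\<close> from every cycle avoiding \<open>v\<close>. If the other
  cycle contains \<open>v\<close>, exchange the roles of the two cycles when both are outside \<open>U\<close>;
  otherwise the other cycle also contains \<open>b1\<close> or \<open>b2\<close>, and the remaining two vertices do not
  support a cycle. The third plane is perpendicular to these. It has \<open>a1\<close> and \<open>b1\<close> on one
  side, \<open>a2\<close> and \<open>b2\<close> on the other, and the remaining four vertices in it. It separates two
  cycles that both have vertices inside and outside \<open>U\<close>: one of them contains \<open>a1\<close> and
  \<open>b1\<close>, the other \<open>a2\<close> and \<open>b2\<close>. (Two such disjoint cycles exist only if the arcs
  leaving \<open>U\<close> have no common end.) That the drawing has no crossings is checked by computing determinants
  and, for coplanar edges, separating planes (\<open>place_segments_meet\<close>).
\<close>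

section \<open>Split links from separating planes\<close>

lemma split_link_commute: "split_link K L \<Longrightarrow> split_link L K"
  unfolding split_link_def by (metis Un_commute)

text \<open>
  The separating 2-sphere is the image under \<open>k\<close> of the boundary of the ball. In the complement of this
  sphere the image of the open ball is clopen: it is open because \<open>k\<close> is a homeomorphism onto an open
  subset of the 3-sphere, and closed because adding the sphere makes it compact. Hence no component contains both it and
  the image of the outside of the ball.
\<close>
lemma split_link_of_ball:
  assumes hom: "homeomorphism (S3 - {p}) (UNIV :: (real ^ 3) set) h k" and p: "p \<in> S3"
    and r: "0 < r" and K: "K \<subseteq> ball z r" and L: "L \<inter> cball z r = {}"
  shows "split_link (k ` K) (k ` L)"
proof -
  define S where "S = k ` sphere z r"
  have hk: "h (k x) = x" for x
    using hom by (simp add: homeomorphism_def)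
  have inj: "inj k"
    by (metis hk injI)
  have kS3: "k ` X \<subseteq> S3 - {p}" for X
    using homeomorphism_image2[OF hom] by blast
  have cont: "continuous_on X k" for X
    using homeomorphism_cont2[OF hom] continuous_on_subset by blast
  have SS: "S \<subseteq> S3"
    using kS3 unfolding S_def by blast
  have part: "k ` X \<subseteq> S3 - S \<longleftrightarrow> X \<inter> sphere z r = {}" for X
  proof -
    have "k ` X \<inter> S = k ` (X \<inter> sphere z r)"
      unfolding S_def by (rule image_Int[OF inj, symmetric])
    then show ?thesis
      using kS3[of X] by blast
  qed
  have homS: "S homeomorphic sphere (0 :: real ^ 3) 1"
  proof -
    have "sphere z r homeomorphic S"
      unfolding S_def
      by (rule homeomorphic_compact[OF compact_sphere cont refl]) (use inj in \<open>auto intro: inj_on_subset\<close>)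
    moreover have "sphere z r homeomorphic sphere (0 :: real ^ 3) 1"
      using r by (simp add: homeomorphic_spheres)
    ultimately show ?thesis
      by (meson homeomorphic_sym homeomorphic_trans)
  qed
  define U where "U = k ` ball z r"
  define W where "W = k ` (- cball z r)"
  have UW: "U \<inter> W = {}"
    using inj unfolding U_def W_def by (auto dest: injD)
  have Usub: "U \<subseteq> S3 - S" and Wsub: "W \<subseteq> S3 - S"
    unfolding U_def W_def part by auto
  have Uconn: "topological_space_class.connected U"
    unfolding U_def by (rule connected_continuous_image[OF cont]) simp
  have Wconn: "topological_space_class.connected W"
    unfolding W_def by (rule connected_continuous_image[OF cont])
      (simp add: connected_complement_bounded_convex)
  have Une: "U \<noteq> {}"
    using r by (simp add: U_def)
  have Wne: "W \<noteq> {}"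
  proof -
    have "\<not> UNIV \<subseteq> cball z r"
      by (metis bounded_cball bounded_subset not_bounded_UNIV)
    then show ?thesis
      unfolding W_def by blast
  qed
  have "openin (top_of_set (S3 - {p})) U"
    unfolding U_def
    by (rule homeomorphism_imp_open_map[OF homeomorphism_symD[OF hom]]) simp
  then have "openin (top_of_set S3) U"
    by (rule openin_trans) (simp add: openin_delete)
  then have Uopen: "openin (top_of_set (S3 - S)) U"
    by (rule openin_subset_trans) (use Usub in auto)
  have "cball z r = ball z r \<union> sphere z r"
    by auto
  then have "k ` cball z r = U \<union> S"
    by (simp add: U_def S_def image_Un)
  then have "U = (S3 - S) \<inter> k ` cball z r"
    using Usub by blast
  moreover have "closed (k ` cball z r)"
    by (intro compact_imp_closed compact_continuous_image cont compact_cball)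
  ultimately have Uclosed: "closedin (top_of_set (S3 - S)) U"
    by (simp add: closedin_closed_Int)
  obtain C where C: "C \<in> components (S3 - S)" "U \<subseteq> C"
    using exists_component_superset[OF Usub _ Uconn] Une Usub by auto
  obtain D where D: "D \<in> components (S3 - S)" "W \<subseteq> D"
    using exists_component_superset[OF Wsub _ Wconn] Wne Wsub by auto
  have "C \<noteq> D"
  proof
    assume "C = D"
    then have "topological_space_class.connected C" "C \<subseteq> S3 - S" "W \<subseteq> C"
      using C D by (auto simp: in_components_connected dest: in_components_subset)
    then have "openin (top_of_set C) U" "closedin (top_of_set C) U"
      using openin_subset_trans[OF Uopen C(2)] closedin_subset_trans[OF Uclosed C(2)] by auto
    then have "U = C"
      using \<open>topological_space_class.connected C\<close> Une by (auto simp: connected_clopen)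
    with \<open>W \<subseteq> C\<close> UW Wne show False
      by blast
  qed
  moreover have "k ` K \<subseteq> C"
    using K C by (auto simp: U_def)
  moreover have "k ` L \<subseteq> D"
    using L D by (auto simp: W_def)
  moreover have "S \<subseteq> S3 - (k ` K \<union> k ` L)"
  proof -
    have "k ` (K \<union> L) \<subseteq> S3 - S"
      using K L unfolding part by (auto simp: subset_iff disjoint_iff)
    then show ?thesis
      using SS by auto
  qed
  ultimately show ?thesis
    unfolding split_link_def using homS C(1) D(1) by blast
qed

text \<open>
  A half-space is the increasing union of the balls of radius \<open>R\<close> tangent at the origin to its boundary:
  the point \<open>x\<close> lies in that ball exactly if \<open>(norm x)\<^sup>2 < 2 * R * (u \<bullet> x)\<close>.
  Compactness bounds the \<open>R\<close> needed.
\<close>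
lemma compact_halfspace_in_ball:
  fixes K :: "'a::euclidean_space set"
  assumes "compact K" and u: "norm u = 1" and pos: "\<And>x. x \<in> K \<Longrightarrow> 0 < u \<bullet> x"
  obtains R where "0 < R" "K \<subseteq> ball (R *\<^sub>R u) R"
proof -
  have "bdd_above ((\<lambda>x. (norm x)\<^sup>2 / (u \<bullet> x)) ` K)"
    by (intro bounded_imp_bdd_above compact_imp_bounded compact_continuous_image
        continuous_intros assms) (use pos in force)
  then obtain B where B: "\<And>x. x \<in> K \<Longrightarrow> (norm x)\<^sup>2 / (u \<bullet> x) \<le> B"
    by (auto simp: bdd_above_def)
  define R where "R = max B 1"
  have "x \<in> ball (R *\<^sub>R u) R" if "x \<in> K" for x
  proof -
    have "(norm x)\<^sup>2 \<le> B * (u \<bullet> x)"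
      using B[OF that] pos[OF that] by (simp add: field_simps)
    also have "\<dots> \<le> R * (u \<bullet> x)"
      using pos[OF that] by (intro mult_right_mono) (auto simp: R_def)
    also have "\<dots> < 2 * R * (u \<bullet> x)"
      using pos[OF that] by (simp add: R_def)
    finally have "(norm x)\<^sup>2 < 2 * R * (u \<bullet> x)" .
    moreover have "(dist (R *\<^sub>R u) x)\<^sup>2 = R\<^sup>2 - 2 * R * (u \<bullet> x) + (norm x)\<^sup>2"
      using u unfolding dist_norm power2_norm_eq_inner
      by (simp add: inner_diff_left inner_diff_right norm_eq_1 inner_commute power2_eq_square)
    ultimately have "(dist (R *\<^sub>R u) x)\<^sup>2 < R\<^sup>2"
      by linarith
    then have "dist (R *\<^sub>R u) x < R"
      by (rule power2_less_imp_less) (simp add: R_def)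
    then show ?thesis
      by simp
  qed
  then show ?thesis
    by (intro that[of R]) (auto simp: R_def)
qed

text \<open>
  A nonnegative function that can vanish only where \<open>s\<close> is positive is bounded away from zero on the
  compact set where \<open>s\<close> is not positive. This decides how small the shear below has to be.
\<close>
lemma positive_gap_on_compact:
  fixes f s :: "'a::topological_space \<Rightarrow> real"
  assumes X: "compact X" and f: "continuous_on X f" and s: "continuous_on X s"
    and nonneg: "\<And>x. x \<in> X \<Longrightarrow> 0 \<le> f x" and zero: "\<And>x. x \<in> X \<Longrightarrow> f x = 0 \<Longrightarrow> 0 < s x"
  obtains m where "0 < m" "\<And>x. x \<in> X \<Longrightarrow> s x \<le> 0 \<Longrightarrow> m \<le> f x"
proof (cases "\<exists>x\<in>X. s x \<le> 0")
  case False
  then show ?thesis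
    by (intro that[of 1]) auto
next
  case True
  define Y where "Y = {x \<in> X. s x \<le> 0}"
  have "\<exists>C. closed C \<and> C \<inter> X = s -` {..0} \<inter> X"
    using s unfolding continuous_on_closed_invariant by blast
  then obtain C where "closed C" "Y = X \<inter> C"
    unfolding Y_def by auto
  then have "compact Y"
    using X by (simp add: compact_Int_closed)
  moreover have "continuous_on Y f"
    using f by (rule continuous_on_subset) (auto simp: Y_def)
  moreover have "Y \<noteq> {}"
    using True by (auto simp: Y_def)
  ultimately obtain y where y: "y \<in> Y" "\<forall>x\<in>Y. f y \<le> f x"
    using continuous_attains_inf by blast
  show ?thesis
  proof (rule that[of "f y"])
    show "0 < f y"
      using y(1) nonneg[of y] zero[of y] by (force simp: Y_def less_le)
    show "f y \<le> f x" if "x \<in> X" "s x \<le> 0" for x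
      using y(2) that by (simp add: Y_def)
  qed
qed

text \<open>
  Sets that meet the bounding plane only in disjoint parts can be pulled apart by a shear \<open>H\<close> along the
  normal \<open>u\<close>. It moves a point by \<open>\<epsilon> * s x\<close>, where \<open>s\<close> depends on the
  projection of the point to the plane only and is \<open>1\<close> on the part of \<open>K\<close> in the plane and
  \<open>-1\<close> on the part of \<open>L\<close>. A point of \<open>K\<close> that is moved the wrong way has at
  least a certain distance from the plane, so a small \<open>\<epsilon>\<close> never takes it to the other side.
\<close>
lemma halfspace_shear:
  fixes K L :: "'a::euclidean_space set"
  assumes "compact K" "compact L" and u: "norm u = 1"
    and K: "\<And>x. x \<in> K \<Longrightarrow> 0 \<le> u \<bullet> x" and L: "\<And>x. x \<in> L \<Longrightarrow> u \<bullet> x \<le> 0"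
    and disj: "K \<inter> L = {}"
  obtains H H' where "homeomorphism UNIV UNIV H H'"
    "\<And>x. x \<in> K \<Longrightarrow> 0 < u \<bullet> H x" "\<And>x. x \<in> L \<Longrightarrow> u \<bullet> H x < 0"
proof -
  have uu: "u \<bullet> u = 1"
    using u by (simp add: norm_eq_1)
  define E where "E = {x. u \<bullet> x = 0}"
  have E: "closed E"
    by (simp add: E_def closed_hyperplane)
  obtain g :: "'a \<Rightarrow> real" where g: "continuous_on UNIV g" "\<And>x. g x \<in> closed_segment 1 (-1)"
      "\<And>x. x \<in> K \<inter> E \<Longrightarrow> g x = 1" "\<And>x. x \<in> L \<inter> E \<Longrightarrow> g x = -1"
    by (rule Urysohn[of "K \<inter> E" "L \<inter> E" 1 "-1 :: real"])
      (use assms(1,2) E disj in \<open>auto intro: closed_Int compact_imp_closed\<close>)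
  have g1: "\<bar>g x\<bar> \<le> 1" for x
    using g(2)[of x] by (auto simp: closed_segment_eq_real_ivl split: if_splits)
  define \<pi> where "\<pi> x = x - (u \<bullet> x) *\<^sub>R u" for x
  define s where "s x = g (\<pi> x)" for x
  have s_cont: "continuous_on A s" for A
    unfolding s_def \<pi>_def
    by (rule continuous_on_compose2[OF g(1)]) (auto intro!: continuous_intros)
  have s1: "\<bar>s x\<bar> \<le> 1" for x
    unfolding s_def by (rule g1)
  \<comment> \<open>Because of this invariance, the shear is inverted by changing the sign of \<open>\<epsilon>\<close>.\<close>
  have s_shift: "s (x + t *\<^sub>R u) = s x" for x t
    by (simp add: s_def \<pi>_def inner_add_right uu scaleR_add_left)
  have s_E: "s x = g x" if "u \<bullet> x = 0" for x
    using that by (simp add: s_def \<pi>_def)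
  have u_cont: "continuous_on A (\<lambda>x. u \<bullet> x)" for A
    by (intro continuous_intros)
  obtain m where m: "0 < m" "\<And>x. x \<in> K \<Longrightarrow> s x \<le> 0 \<Longrightarrow> m \<le> u \<bullet> x"
    by (rule positive_gap_on_compact[OF \<open>compact K\<close> u_cont s_cont])
      (use K g(3) s_E in \<open>auto simp: E_def\<close>)
  obtain n where n: "0 < n" "\<And>x. x \<in> L \<Longrightarrow> - s x \<le> 0 \<Longrightarrow> n \<le> - (u \<bullet> x)"
    by (rule positive_gap_on_compact[OF \<open>compact L\<close> continuous_on_minus[OF u_cont]
          continuous_on_minus[OF s_cont]])
      (use L g(4) s_E in \<open>auto simp: E_def\<close>)
  define \<epsilon> where "\<epsilon> = min m n / 2"
  have \<epsilon>: "0 < \<epsilon>" "\<epsilon> < m" "\<epsilon> < n"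
    using m(1) n(1) by (auto simp: \<epsilon>_def min_def)
  have \<epsilon>s: "\<bar>\<epsilon> * s x\<bar> \<le> \<epsilon>" for x
    using s1[of x] \<epsilon>(1) by (simp add: abs_mult mult_left_le)
  define H where "H x = x + (\<epsilon> * s x) *\<^sub>R u" for x
  define H' where "H' x = x + (- \<epsilon> * s x) *\<^sub>R u" for x
  have uH: "u \<bullet> H x = u \<bullet> x + \<epsilon> * s x" for x
    by (simp add: H_def inner_add_right uu)
  show ?thesis
  proof (rule that[of H H'])
    have "H (H' x) = x" "H' (H x) = x" for x
      by (simp_all only: H_def H'_def s_shift) (simp_all add: algebra_simps)
    moreover have "continuous_on UNIV H" "continuous_on UNIV H'"
      unfolding H_def H'_def by (intro continuous_intros s_cont)+
    ultimately show "homeomorphism UNIV UNIV H H'"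
      by (intro homeomorphismI) auto
    show "0 < u \<bullet> H x" if "x \<in> K" for x
    proof (cases "0 < s x")
      case True
      then show ?thesis
        using K[OF that] \<epsilon>(1) by (simp add: uH add_nonneg_pos)
    next
      case False
      then show ?thesis
        using m(2)[OF that] \<epsilon>(2) \<epsilon>s[of x] by (simp add: uH abs_le_iff)
    qed
    show "u \<bullet> H x < 0" if "x \<in> L" for x
    proof (cases "s x < 0")
      case True
      then have "\<epsilon> * s x < 0"
        using \<epsilon>(1) by (simp add: mult_pos_neg)
      then show ?thesis
        using L[OF that] by (simp add: uH)
    next
      case False
      then show ?thesis
        using n(2)[OF that] \<epsilon>(3) \<epsilon>s[of x] by (simp add: uH abs_le_iff)
    qed
  qed
qed

text \<open>
  The geometric heart of the argument. The plane is allowed to meet both sets, so that two polygons with vertices in it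
  are covered as well; it is enough that they are disjoint.
\<close>
proposition split_link_of_weakly_separating_plane:
  assumes hom: "homeomorphism (S3 - {p}) (UNIV :: (real ^ 3) set) h k" and p: "p \<in> S3"
    and cpt: "compact K" "compact L" and disj: "K \<inter> L = {}" and u: "norm u = 1"
    and K: "\<And>x. x \<in> K \<Longrightarrow> c \<le> u \<bullet> x" and L: "\<And>x. x \<in> L \<Longrightarrow> u \<bullet> x \<le> c"
  shows "split_link (k ` K) (k ` L)"
proof -
  define \<tau> where "\<tau> x = x - c *\<^sub>R u" for x
  have u\<tau>: "u \<bullet> \<tau> x = u \<bullet> x - c" for x
    using u by (simp add: \<tau>_def inner_diff_right norm_eq_1)
  have \<tau>_cont: "continuous_on A \<tau>" for A
    unfolding \<tau>_def by (intro continuous_intros)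
  have \<tau>_hom: "homeomorphism UNIV UNIV \<tau> (\<lambda>x. x + c *\<^sub>R u)"
    by (intro homeomorphismI \<tau>_cont continuous_intros) (auto simp: \<tau>_def)
  have "\<tau> ` K \<inter> \<tau> ` L = {}"
    using disj by (auto simp: \<tau>_def)
  then obtain H H' where H: "homeomorphism UNIV UNIV H H'"
      "\<And>x. x \<in> \<tau> ` K \<Longrightarrow> 0 < u \<bullet> H x" "\<And>x. x \<in> \<tau> ` L \<Longrightarrow> u \<bullet> H x < 0"
    by (rule halfspace_shear[OF compact_continuous_image[OF \<tau>_cont cpt(1)]
          compact_continuous_image[OF \<tau>_cont cpt(2)] u, rotated 2])
      (use K L in \<open>auto simp: u\<tau>\<close>)
  define F where "F = H \<circ> \<tau>"
  define F' where "F' = (\<lambda>x. x + c *\<^sub>R u) \<circ> H'"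
  have F: "homeomorphism UNIV UNIV F F'"
    unfolding F_def F'_def by (rule homeomorphism_compose[OF \<tau>_hom H(1)])
  then have cF: "compact (F ` K)"
    using cpt(1) by (meson compact_continuous_image continuous_on_subset homeomorphism_def subset_UNIV)
  obtain R where R: "0 < R" "F ` K \<subseteq> ball (R *\<^sub>R u) R"
    by (rule compact_halfspace_in_ball[OF cF u]) (use H(2) in \<open>auto simp: F_def\<close>)
  have "F ` L \<inter> cball (R *\<^sub>R u) R = {}"
  proof -
    have "R < dist (R *\<^sub>R u) x" if "u \<bullet> x < 0" for x
    proof -
      have "R * (u \<bullet> u) < u \<bullet> (R *\<^sub>R u - x)"
        using that by (simp add: inner_diff_right)
      also have "\<dots> \<le> dist (R *\<^sub>R u) x"
        using Cauchy_Schwarz_ineq2[of u "R *\<^sub>R u - x"] u by (simp add: dist_norm abs_le_iff)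
      finally show ?thesis
        using u by (simp add: norm_eq_1)
    qed
    then show ?thesis
      using H(3) by (fastforce simp: F_def)
  qed
  with split_link_of_ball[OF homeomorphism_compose[OF hom F] p R]
  have "split_link ((k \<circ> F') ` F ` K) ((k \<circ> F') ` F ` L)"
    by blast
  moreover have "(k \<circ> F') ` F ` X = k ` X" for X
    using F by (simp add: image_comp homeomorphism_def)
  ultimately show ?thesis
    by simp
qed

section \<open>Cycles and cuts in tournaments\<close>

lemma (in pre_digraph) cas_ends:
  "cas u p v \<Longrightarrow> insert v (tail G ` set p) = insert u (head G ` set p)"
  by (induction p arbitrary: u) auto

lemma (in pre_digraph) cas_last_head:
  "cas u p v \<Longrightarrow> p \<noteq> [] \<Longrightarrow> v \<in> head G ` set p"
proof (induction p arbitrary: u)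
  case (Cons e p)
  then show ?case
    by (cases "p = []") auto
qed simp

lemma (in pre_digraph) cycle_heads_eq_tails:
  assumes "cycle c"
  shows "head G ` set c = tail G ` set c"
proof -
  obtain u where u: "cas u c u" "c \<noteq> []"
    using assms by (auto simp: cycle_def awalk_def)
  then have "u \<in> tail G ` set c" "u \<in> head G ` set c"
    by (cases c; simp) (rule cas_last_head[OF u])
  then show ?thesis
    using cas_ends[OF u(1)] by (simp add: insert_absorb)
qed

text \<open>
  A closed walk that enters or leaves \<open>U\<close> does both: if no arc left \<open>U\<close>, the walk would be
  caught in \<open>U\<close> after its first vertex there, and could not close up outside.
\<close>
lemma (in pre_digraph) cycle_crosses_cut:
  assumes "cycle c" and "\<not> tail G ` set c \<subseteq> U" and "tail G ` set c \<inter> U \<noteq> {}"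
  obtains e where "e \<in> set c" "tail G e \<in> U" "head G e \<notin> U"
proof -
  have walk: "(u \<in> U \<longrightarrow> v \<in> U \<and> tail G ` set p \<subseteq> U) \<and> (v \<notin> U \<longrightarrow> tail G ` set p \<inter> U = {})"
    if "cas u p v" "\<forall>e\<in>set p. tail G e \<in> U \<longrightarrow> head G e \<in> U" for u p v
    using that by (induction p arbitrary: u) auto
  obtain u where "cas u c u"
    using assms by (auto simp: cycle_def awalk_def)
  then have "\<not> (\<forall>e\<in>set c. tail G e \<in> U \<longrightarrow> head G e \<in> U)"
    using walk[of u c u] assms(2,3) by blast
  then show ?thesis
    using that by blast
qed

lemma (in pre_digraph) cycle_arcs: "cycle c \<Longrightarrow> set c \<subseteq> arcs G"
  by (auto simp: cycle_def awalk_def)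

lemma tournament_arc_eqI:
  assumes "tournament G" "e \<in> arcs G" "e' \<in> arcs G" "{tail G e, head G e} = {tail G e', head G e'}"
  shows "e = e'"
proof -
  interpret loopfree_digraph G
    using assms(1) by (simp add: tournament_def)
  have "\<exists>!a. a \<in> arcs G \<and> {tail G a, head G a} = {tail G e, head G e}"
    using assms(1,2) no_loops unfolding tournament_def by simp
  then show ?thesis
    using assms(2-4) by metis
qed

text \<open>
  Two vertices of a tournament are joined by one arc only, and so there is no way back.
\<close>
lemma tournament_cycle_not_within_pair:
  assumes "tournament G" "pre_digraph.cycle G c"
  shows "\<not> tail G ` set c \<subseteq> {s, t}"
proof
  assume sub: "tail G ` set c \<subseteq> {s, t}"
  interpret loopfree_digraph G
    using assms(1) by (simp add: tournament_def)
  have heads: "head G ` set c = tail G ` set c" and arcs: "set c \<subseteq> arcs G" and "c \<noteq> []"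
    using assms(2) cycle_heads_eq_tails cycle_arcs by (auto simp: cycle_def)
  then obtain e where e: "e \<in> set c"
    by (meson last_in_set)
  have ends: "{tail G e', head G e'} = {s, t}" if "e' \<in> set c" for e'
  proof -
    have "tail G e' \<in> {s, t}" "head G e' \<in> {s, t}"
      using that sub heads by blast+
    then show ?thesis
      using no_loops[of e'] that arcs by auto
  qed
  have "e' = e" if "e' \<in> set c" for e'
    using that e arcs by (intro tournament_arc_eqI[OF assms(1)]) (auto simp: ends)
  then have "set c = {e}"
    using e by blast
  then have "head G e = tail G e" "e \<in> arcs G"
    using heads arcs by simp_all
  then show False
    using no_loops[of e] by simp
qed

lemma tournament_card_induced_arcs:
  assumes "tournament G" "U \<subseteq> verts G"
  shows "card {e \<in> arcs G. tail G e \<in> U \<and> head G e \<in> U} = card U choose 2"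
proof -
  interpret fin_digraph G
    using assms(1) by (simp add: tournament_def)
  interpret loopfree_digraph G
    using assms(1) by (simp add: tournament_def)
  have "bij_betw (\<lambda>e. {tail G e, head G e}) {e \<in> arcs G. tail G e \<in> U \<and> head G e \<in> U}
      {s. s \<subseteq> U \<and> card s = 2}"
    unfolding bij_betw_def
  proof (intro conjI inj_onI subset_antisym subsetI)
    fix s assume "s \<in> {s. s \<subseteq> U \<and> card s = 2}"
    then obtain u v where s: "s = {u, v}" "u \<noteq> v" "u \<in> U" "v \<in> U"
      by (auto simp: card_2_iff)
    then obtain e where "e \<in> arcs G" "{tail G e, head G e} = s"
      using assms unfolding tournament_def by (meson subsetD)
    moreover from this have "tail G e \<in> U" "head G e \<in> U"
      using s by auto
    ultimately show "s \<in> (\<lambda>e. {tail G e, head G e}) ` {e \<in> arcs G. tail G e \<in> U \<and> head G e \<in> U}"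
      by blast
  qed (use assms no_loops in \<open>auto simp: card_2_iff intro: tournament_arc_eqI\<close>)
  then show ?thesis
    using finite_subset[OF assms(2) finite_verts] by (simp add: bij_betw_same_card n_subsets)
qed

text \<open>
  The outdegrees count the arcs starting in \<open>U\<close>, and those that also end in \<open>U\<close> correspond to
  the pairs in \<open>U\<close>. With \<open>card U = 4\<close> and outdegree sum 8, exactly \<open>8 - 6 = 2\<close>
  arcs leave \<open>U\<close>.
\<close>
lemma tournament_card_leaving_arcs:
  assumes "tournament G" "U \<subseteq> verts G"
  shows "(card U choose 2) + card {e \<in> arcs G. tail G e \<in> U \<and> head G e \<notin> U} = (\<Sum>v\<in>U. out_degree G v)"
proof -
  interpret fin_digraph G
    using assms(1) by (simp add: tournament_def)
  have "(\<Sum>v\<in>U. out_degree G v) = card (\<Union>v\<in>U. out_arcs G v)"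
    unfolding out_degree_def
    by (rule card_UN_disjoint[symmetric])
      (use finite_subset[OF assms(2) finite_verts] in \<open>auto simp: out_arcs_def\<close>)
  also have "(\<Union>v\<in>U. out_arcs G v) = {e \<in> arcs G. tail G e \<in> U \<and> head G e \<in> U}
      \<union> {e \<in> arcs G. tail G e \<in> U \<and> head G e \<notin> U}"
    by auto
  also have "card \<dots> = (card U choose 2) + card {e \<in> arcs G. tail G e \<in> U \<and> head G e \<notin> U}"
    by (subst card_Un_disjoint) (auto simp: tournament_card_induced_arcs[OF assms])
  finally show ?thesis
    by simp
qed

text \<open>
  Used for the tails of the two arcs that leave \<open>U\<close>, and again for their heads. These may coincide, in
  which case the second special vertex \<open>s'\<close> is arbitrary.
\<close>
lemma label_four:
  assumes "card U = 4" "s \<in> U" "t \<in> U"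
  obtains s' x y where "U = {s, s', x, y}" "distinct [s, s', x, y]" "t = s \<or> t = s'"
proof -
  have fin: "finite U"
    using assms(1) card.infinite by force
  obtain s' where s': "s' \<in> U" "s' \<noteq> s" "t = s \<or> t = s'"
  proof (cases "t = s")
    case True
    have "card (U - {s}) = 3"
      using assms fin by simp
    then have "U - {s} \<noteq> {}"
      by (metis card.empty zero_neq_numeral)
    then show ?thesis
      using that True by auto
  next
    case False
    then show ?thesis
      using that assms by auto
  qed
  have "card (U - {s, s'}) = 2"
    using assms fin s' by (simp add: card_Diff_subset)
  then obtain x y where xy: "U - {s, s'} = {x, y}" "x \<noteq> y"
    by (auto simp: card_2_iff)
  then have "U = {s, s', x, y}" "x \<notin> {s, s'}" "y \<notin> {s, s'}"
    using assms s' by auto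
  then show ?thesis
    using that[of s' x y] s' xy(2) by auto
qed

section \<open>A straight-line drawing of the complete graph on eight vertices\<close>

text \<open>
  The hypothesis says that the tetrahedron has nonzero volume.
\<close>
lemma affine_independent_tetrahedron:
  fixes a b c d :: "real ^ 3"
  assumes vol: "cross3 (b - a) (c - a) \<bullet> (d - a) \<noteq> 0"
  shows "\<not> affine_dependent {a, b, c, d}"
proof -
  let ?n = "cross3 (b - a) (c - a)"
  have "\<not> collinear {0, b - a, c - a}"
    using vol cross_eq_0[of "b - a" "c - a"] by auto
  then have "\<not> collinear {b, a, c}"
    using collinear_3[of b a c] by (simp add: NO_MATCH_def)
  then have "\<not> affine_dependent {b, a, c}"
    by (simp add: collinear_3_eq_affine_dependent)
  moreover have "d \<notin> affine hull {b, a, c}"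
  proof -
    have "affine hull {b, a, c} \<subseteq> {z. ?n \<bullet> z = ?n \<bullet> a}"
    proof (intro hull_minimal affine_hyperplane)
      have "?n \<bullet> (b - a) = 0" "?n \<bullet> (c - a) = 0"
        by (simp_all add: dot_cross_self)
      then show "{b, a, c} \<subseteq> {z. ?n \<bullet> z = ?n \<bullet> a}"
        by (simp add: inner_diff_right)
    qed
    then show ?thesis
      using vol by (auto simp: inner_diff_right)
  qed
  ultimately have "\<not> affine_dependent (insert d {b, a, c})"
    by (rule affine_independent_insert)
  then show ?thesis
    by (simp add: insert_commute)
qed

lemma segments_meet_in_common_ends:
  fixes P :: "'i \<Rightarrow> 'a::euclidean_space"
  assumes "\<not> affine_dependent (P ` {i, j, k, l})" and inj: "inj_on P {i, j, k, l}"
    and "i \<noteq> j" "k \<noteq> l" "{i, j} \<noteq> {k, l}"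
  shows "closed_segment (P i) (P j) \<inter> closed_segment (P k) (P l) = P ` ({i, j} \<inter> {k, l})"
proof -
  have "closed_segment (P i) (P j) \<inter> closed_segment (P k) (P l)
      = convex hull (P ` {i, j} \<inter> P ` {k, l})"
    using assms(1) by (subst convex_hull_Int) (auto simp: segment_convex_hull insert_commute)
  also have "P ` {i, j} \<inter> P ` {k, l} = P ` ({i, j} \<inter> {k, l})"
    by (rule inj_on_image_Int[OF inj, symmetric]) auto
  also have "convex hull (P ` ({i, j} \<inter> {k, l})) = P ` ({i, j} \<inter> {k, l})"
  proof -
    consider "{i, j} \<inter> {k, l} = {}" | m where "{i, j} \<inter> {k, l} = {m}"
      using assms(3-5) by fastforce
    then show ?thesis
      by cases auto
  qed
  finally show ?thesis .
qed

lemma segments_disjoint_by_plane: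
  fixes a b a' b' n :: "'a::real_inner"
  assumes "n \<bullet> a < n \<bullet> a'" "n \<bullet> a < n \<bullet> b'" "n \<bullet> b < n \<bullet> a'" "n \<bullet> b < n \<bullet> b'"
  shows "closed_segment a b \<inter> closed_segment a' b' = {}"
proof -
  define c where "c = max (n \<bullet> a) (n \<bullet> b)"
  have "closed_segment a b \<subseteq> {z. n \<bullet> z \<le> c}"
    by (intro closed_segment_subset convex_halfspace_le) (auto simp: c_def)
  moreover have "closed_segment a' b' \<subseteq> {z. n \<bullet> z > c}"
    by (intro closed_segment_subset convex_halfspace_gt) (use assms in \<open>auto simp: c_def\<close>)
  ultimately show ?thesis
    by force
qed

text \<open>
  The vertices of the drawing, in the order \<open>a1, a2, x, y, b1, b2, w, v\<close>; the first four are for \<open>U\<close>, and the arcs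
  leaving \<open>U\<close> go from \<open>a1\<close> to \<open>b1\<close> and from \<open>a2\<close> to \<open>b2\<close>. With coordinates \<open>p, q, r\<close>:
  \<^item> \<open>U\<close> lies in the plane \<open>q = 1\<close>, above everything else in direction \<open>q\<close>;
  \<^item> \<open>b1, b2, w\<close> lie in the plane \<open>q = -1\<close>, and \<open>v\<close> is the only vertex below it;
  \<^item> \<open>x, y, w, v\<close> lie in the plane \<open>r = 0\<close>, with \<open>w\<close> inside the triangle of the others, so that the six edges
    between them do not cross;
  \<^item> \<open>a1\<close> and \<open>b1\<close> lie above the plane \<open>r = 0\<close>, and \<open>a2\<close> and \<open>b2\<close> below.
  The point \<open>w\<close> has to be inside that triangle: if \<open>w\<close> and \<open>v\<close> were both in the plane \<open>q = -1\<close>, the four points would be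
  in convex position and two edges would cross. The remaining freedom is used to make the two quadruples
  \<open>a1, a2, x, y\<close> and \<open>x, y, w, v\<close> the only coplanar ones. Integers make this decidable by computation.
\<close>
definition corner :: "nat \<Rightarrow> int \<times> int \<times> int" where
  "corner i = [(5,1,1), (5,1,-1), (-2,1,0), (2,1,0), (1,-1,1), (4,-1,-1), (0,-1,0), (0,-5,0)] ! i"

fun dot :: "int \<times> int \<times> int \<Rightarrow> int \<times> int \<times> int \<Rightarrow> int" where
  "dot (a1,a2,a3) (b1,b2,b3) = a1 * b1 + a2 * b2 + a3 * b3"

text \<open>
  Six times the signed volume of a tetrahedron, in expanded form.
\<close>
fun orient :: "int \<times> int \<times> int \<Rightarrow> int \<times> int \<times> int \<Rightarrow> int \<times> int \<times> int \<Rightarrow> int \<times> int \<times> int \<Rightarrow> int" where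
  "orient (a1,a2,a3) (b1,b2,b3) (c1,c2,c3) (d1,d2,d3) =
    ((b2-a2)*(c3-a3)-(b3-a3)*(c2-a2))*(d1-a1) + ((b3-a3)*(c1-a1)-(b1-a1)*(c3-a3))*(d2-a2)
     + ((b1-a1)*(c2-a2)-(b2-a2)*(c1-a1))*(d3-a3)"

text \<open>
  Normals of planes that separate opposite edges of the coplanar quadruples. For \<open>a1, a2, x, y\<close> (where
  \<open>y\<close> lies inside the triangle of the other three) the planes are perpendicular to \<open>q = 1\<close>,
  for \<open>x, y, w, v\<close> to \<open>r = 0\<close>. Both signs occur because the separation below is stated in one
  direction.
\<close>
definition normals :: "(int \<times> int \<times> int) list" where
  "normals = [(1,0,0), (-1,0,0), (0,1,0), (0,-1,0), (1,0,-7), (-1,0,7), (1,0,7), (-1,0,-7),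
     (3,-1,0), (-3,1,0), (3,1,0), (-3,-1,0)]"

lemma corner_pairs_separated:
  "\<forall>i\<in>set [0..<8]. \<forall>j\<in>set [0..<8]. \<forall>k\<in>set [0..<8]. \<forall>l\<in>set [0..<8]. distinct [i, j, k, l] \<longrightarrow>
     orient (corner i) (corner j) (corner k) (corner l) \<noteq> 0 \<or>
     (\<exists>n\<in>set normals. dot n (corner i) < dot n (corner k) \<and> dot n (corner i) < dot n (corner l) \<and>
        dot n (corner j) < dot n (corner k) \<and> dot n (corner j) < dot n (corner l))"
  by code_simp

lemma corner_triples_in_tetrahedron:
  "\<forall>i\<in>set [0..<8]. \<forall>j\<in>set [0..<8]. \<forall>k\<in>set [0..<8]. distinct [i, j, k] \<longrightarrow>
     (\<exists>l\<in>set [0..<8]. orient (corner i) (corner j) (corner k) (corner l) \<noteq> 0)"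
  by code_simp

lemma distinct_corners: "distinct (map corner [0..<8])"
  by code_simp

definition real_point :: "int \<times> int \<times> int \<Rightarrow> real ^ 3" where
  "real_point a = (case a of (p, q, r) \<Rightarrow> vector [of_int p, of_int q, of_int r])"

lemma inj_real_point: "inj real_point"
  by (auto intro!: injI simp: real_point_def vec_eq_iff forall_3)

lemma inner_real_point: "real_point a \<bullet> real_point b = of_int (dot a b)"
  by (cases a; cases b) (simp add: real_point_def inner_vec_def sum_3)

lemma volume_real_point:
  "cross3 (real_point b - real_point a) (real_point c - real_point a) \<bullet> (real_point d - real_point a)
    = of_int (orient a b c d)"
  by (cases a; cases b; cases c; cases d)
    (simp add: real_point_def cross3_def inner_vec_def sum_3)

definition place :: "nat \<Rightarrow> real ^ 3" where
  "place i = real_point (corner i)"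

lemma inj_place: "inj_on place {..<8}"
proof -
  have "inj_on corner {..<8}"
    using distinct_corners by (simp add: distinct_map lessThan_atLeast0)
  then show ?thesis
    unfolding place_def
    by (rule comp_inj_on[of corner _ real_point, unfolded comp_def])
      (rule inj_on_subset[OF inj_real_point subset_UNIV])
qed

lemma place_independent:
  assumes "orient (corner i) (corner j) (corner k) (corner l) \<noteq> 0"
  shows "\<not> affine_dependent (place ` {i, j, k, l})"
proof -
  have "\<not> affine_dependent {place i, place j, place k, place l}"
    by (rule affine_independent_tetrahedron) (simp add: place_def volume_real_point assms)
  then show ?thesis
    by simp
qed

text \<open>
  Two disjoint edges span a tetrahedron or are separated by one of the listed planes. Two edges with a common end span a
  triangle, which is a face of some tetrahedron of nonzero volume.
\<close>
lemma place_segments_meet: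
  assumes "i < 8" "j < 8" "k < 8" "l < 8" and neq: "i \<noteq> j" "k \<noteq> l" "{i, j} \<noteq> {k, l}"
  shows "closed_segment (place i) (place j) \<inter> closed_segment (place k) (place l)
    \<subseteq> place ` ({i, j} \<inter> {k, l})"
proof -
  have in8: "i \<in> set [0..<8]" "j \<in> set [0..<8]" "k \<in> set [0..<8]" "l \<in> set [0..<8]"
    using assms by auto
  consider n where "dot n (corner i) < dot n (corner k)" "dot n (corner i) < dot n (corner l)"
      "dot n (corner j) < dot n (corner k)" "dot n (corner j) < dot n (corner l)"
    | "\<not> affine_dependent (place ` {i, j, k, l})"
  proof (cases "distinct [i, j, k, l]")
    case True
    then show ?thesis
      using corner_pairs_separated in8 place_independent that by blast
  next
    case False
    then obtain m where m: "m \<in> {k, l}" "{i, j, k, l} = {i, j, m}" "distinct [i, j, m]"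
      using neq by auto
    with in8 have "m \<in> set [0..<8]"
      by auto
    with m(3) in8 obtain r where "orient (corner i) (corner j) (corner m) (corner r) \<noteq> 0"
      using corner_triples_in_tetrahedron by blast
    then have "\<not> affine_dependent (place ` {i, j, m, r})"
      by (rule place_independent)
    then have "\<not> affine_dependent (place ` {i, j, m})"
      by (rule affine_independent_subset) auto
    then show ?thesis
      using that(2) m(2) by simp
  qed
  then show ?thesis
  proof cases
    case (1 n)
    then have "closed_segment (place i) (place j) \<inter> closed_segment (place k) (place l) = {}"
      by (intro segments_disjoint_by_plane[of "real_point n"]) (simp_all add: place_def inner_real_point)
    then show ?thesis
      by simp
  next
    case 2
    moreover have "inj_on place {i, j, k, l}"
      by (rule inj_on_subset[OF inj_place]) (use assms in auto)
    ultimately show ?thesis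
      using segments_meet_in_common_ends[of place i j k l] neq by simp
  qed
qed

text \<open>
  Otherwise the edge would meet the edge from \<open>i\<close> to \<open>m\<close> in the point \<open>place m\<close>
  as well.
\<close>
lemma place_on_segment:
  assumes "i < 8" "j < 8" "m < 8" "i \<noteq> j" "place m \<in> closed_segment (place i) (place j)"
  shows "m \<in> {i, j}"
proof (rule ccontr)
  assume "m \<notin> {i, j}"
  then have "{i, j} \<noteq> {i, m}" "i \<noteq> m" "{i, j} \<inter> {i, m} = {i}"
    by auto
  then have "place m = place i"
    using place_segments_meet[of i j i m] assms by auto
  then show False
    using inj_place assms \<open>i \<noteq> m\<close> by (auto dest: inj_onD)
qed

lemma place_coordinates:
  "place i $ 2 = of_int (fst (snd (corner i)))"
  "place i $ 3 = of_int (snd (snd (corner i)))"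
  by (simp_all add: place_def real_point_def split: prod.split)

section \<open>Straight-line drawings as tame embeddings\<close>

lemma punctured_sphere_homeomorphic_space:
  assumes "p \<in> S3"
  obtains h k where "homeomorphism (S3 - {p}) (UNIV :: (real ^ 3) set) h k"
proof -
  have "S3 - {p} homeomorphic (UNIV :: (real ^ 3) set)"
    by (rule homeomorphic_punctured_sphere_affine) (use assms in auto)
  then show ?thesis
    using that unfolding homeomorphic_def by blast
qed

text \<open>
  Edges meet in the common ends of the arcs only, which is slightly stronger than meeting in vertices. In this form the
  drawing keeps vertex-disjoint cycles disjoint.
\<close>
definition straight_drawing :: "('a, 'b) pre_digraph \<Rightarrow> ('a \<Rightarrow> real ^ 3) \<Rightarrow> bool" where
  "straight_drawing G P \<longleftrightarrow> inj_on P (verts G) \<and>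
     (\<forall>e\<in>arcs G. \<forall>v\<in>verts G.
        P v \<in> closed_segment (P (tail G e)) (P (head G e)) \<longrightarrow> v \<in> {tail G e, head G e}) \<and>
     (\<forall>e\<in>arcs G. \<forall>e'\<in>arcs G. e \<noteq> e' \<longrightarrow>
        closed_segment (P (tail G e)) (P (head G e)) \<inter> closed_segment (P (tail G e')) (P (head G e'))
          \<subseteq> P ` ({tail G e, head G e} \<inter> {tail G e', head G e'}))"

lemma tame_embedding_of_straight_drawing:
  assumes "loopfree_digraph G" and P: "straight_drawing G P" and p: "p \<in> S3"
    and hom: "homeomorphism (S3 - {p}) (UNIV :: (real ^ 3) set) h k"
  shows "tame_embedding_S3 G (k \<circ> P) (\<lambda>e. k \<circ> linepath (P (tail G e)) (P (head G e)))"
proof -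
  interpret loopfree_digraph G
    by fact
  let ?\<gamma> = "\<lambda>e. k \<circ> linepath (P (tail G e)) (P (head G e))"
  let ?s = "\<lambda>e. closed_segment (P (tail G e)) (P (head G e))"
  have hk: "h (k x) = x" for x
    using hom by (simp add: homeomorphism_def)
  have inj: "inj k"
    by (metis hk injI)
  have kS3: "k x \<in> S3 - {p}" for x
    using homeomorphism_image2[OF hom] by blast
  have cont: "continuous_on X k" for X
    using homeomorphism_cont2[OF hom] continuous_on_subset by blast
  have img: "path_image (?\<gamma> e) = k ` ?s e" for e
    by (simp add: path_image_compose)
  have injP: "inj_on P (verts G)"
    using P by (simp add: straight_drawing_def)
  have simple: "simple_path (?\<gamma> e)" if "e \<in> arcs G" for e
  proof (rule simple_path_continuous_image[OF _ cont])
    have "P (tail G e) \<noteq> P (head G e)"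
      using that injP no_loops by (auto dest: inj_onD)
    then show "simple_path (linepath (P (tail G e)) (P (head G e)))"
      by (simp add: arc_imp_simple_path)
    show "inj_on k (path_image (linepath (P (tail G e)) (P (head G e))))"
      using inj by (rule inj_on_subset) simp
  qed
  have "embedding_S3 G (k \<circ> P) ?\<gamma>"
    unfolding embedding_S3_def
  proof (intro conjI ballI impI)
    show "(k \<circ> P) ` verts G \<subseteq> S3"
      using kS3 by auto
    show "inj_on (k \<circ> P) (verts G)"
      using injP inj by (auto intro: comp_inj_on inj_on_subset)
    fix e assume e: "e \<in> arcs G"
    show "simple_path (?\<gamma> e)"
      using e by (rule simple)
    show "path_image (?\<gamma> e) \<subseteq> S3"
      unfolding img using kS3 by auto
    show "pathstart (?\<gamma> e) = (k \<circ> P) (tail G e)" "pathfinish (?\<gamma> e) = (k \<circ> P) (head G e)"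
      by (simp_all add: pathstart_compose pathfinish_compose)
    have on_edge: "v \<in> {tail G e, head G e}" if "v \<in> verts G" "k (P v) \<in> k ` ?s e" for v
      using P e that inj by (simp add: straight_drawing_def inj_image_mem_iff)
    show "path_image (?\<gamma> e) \<inter> (k \<circ> P) ` verts G \<subseteq> {(k \<circ> P) (tail G e), (k \<circ> P) (head G e)}"
    proof
      fix z assume z: "z \<in> path_image (?\<gamma> e) \<inter> (k \<circ> P) ` verts G"
      then obtain v where v: "v \<in> verts G" "z = (k \<circ> P) v"
        by (elim IntE imageE)
      have "z \<in> k ` ?s e"
        using z unfolding img by (rule IntD1)
      then have "k (P v) \<in> k ` ?s e"
        by (simp only: v(2) comp_apply)
      then show "z \<in> {(k \<circ> P) (tail G e), (k \<circ> P) (head G e)}"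
        using on_edge[OF v(1)] v(2) by auto
    qed
    fix e' assume e': "e' \<in> arcs G" "e \<noteq> e'"
    have "?s e \<inter> ?s e' \<subseteq> P ` ({tail G e, head G e} \<inter> {tail G e', head G e'})"
      using P e e' by (simp add: straight_drawing_def)
    also have "\<dots> \<subseteq> P ` verts G"
      using tail_in_verts[OF e] head_in_verts[OF e] by (intro image_mono) blast
    finally show "path_image (?\<gamma> e) \<inter> path_image (?\<gamma> e') \<subseteq> (k \<circ> P) ` verts G"
      unfolding img image_Int[OF inj, symmetric] image_comp[symmetric] by (rule image_mono)
  qed
  moreover have "polygonal (h ` path_image (?\<gamma> e))" for e
  proof -
    have "h ` path_image (?\<gamma> e) = ?s e"
      unfolding img by (simp add: image_comp comp_def hk)
    then show ?thesis
      unfolding polygonal_def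
      by (intro exI[of _ "{(P (tail G e), P (head G e))}"]) simp
  qed
  moreover have "p \<notin> (k \<circ> P) ` verts G" "p \<notin> path_image (?\<gamma> e)" for e
    unfolding img using kS3 by auto
  ultimately show ?thesis
    unfolding tame_embedding_S3_def using p hom by blast
qed

definition cycle_polygon :: "('a, 'b) pre_digraph \<Rightarrow> ('a \<Rightarrow> real ^ 3) \<Rightarrow> 'b list \<Rightarrow> (real ^ 3) set" where
  "cycle_polygon G P c = (\<Union>e\<in>set c. closed_segment (P (tail G e)) (P (head G e)))"

lemma cycle_image_straight:
  "cycle_image (\<lambda>e. k \<circ> linepath (P (tail G e)) (P (head G e))) c = k ` cycle_polygon G P c"
  by (simp add: cycle_image_def cycle_polygon_def path_image_compose image_UN)

lemma compact_cycle_polygon: "compact (cycle_polygon G P c)"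
  unfolding cycle_polygon_def by (intro compact_UN) auto

lemma cycle_polygon_subset_convex:
  assumes "pre_digraph.cycle G c" "convex S" "\<And>v. v \<in> tail G ` set c \<Longrightarrow> P v \<in> S"
  shows "cycle_polygon G P c \<subseteq> S"
proof -
  have "head G ` set c = tail G ` set c"
    using assms(1) by (rule pre_digraph.cycle_heads_eq_tails)
  then have "P (tail G e) \<in> S" "P (head G e) \<in> S" if "e \<in> set c" for e
    using assms(3) that by auto
  then show ?thesis
    unfolding cycle_polygon_def using closed_segment_subset[OF _ _ assms(2)] by blast
qed

lemma disjoint_cycle_polygons:
  assumes P: "straight_drawing G P" and c: "pre_digraph.cycle G c" and d: "pre_digraph.cycle G d"
    and disj: "tail G ` set c \<inter> tail G ` set d = {}"
  shows "cycle_polygon G P c \<inter> cycle_polygon G P d = {}"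
proof -
  note heads = pre_digraph.cycle_heads_eq_tails[OF c] pre_digraph.cycle_heads_eq_tails[OF d]
  have "closed_segment (P (tail G e)) (P (head G e)) \<inter> closed_segment (P (tail G e')) (P (head G e')) = {}"
    if "e \<in> set c" "e' \<in> set d" for e e'
  proof -
    have "{tail G e, head G e} \<subseteq> tail G ` set c"
      using imageI[OF that(1), of "tail G"] imageI[OF that(1), of "head G"] heads(1) by simp
    moreover have "{tail G e', head G e'} \<subseteq> tail G ` set d"
      using imageI[OF that(2), of "tail G"] imageI[OF that(2), of "head G"] heads(2) by simp
    ultimately have common: "{tail G e, head G e} \<inter> {tail G e', head G e'} = {}"
      using Int_mono[of _ "tail G ` set c" _ "tail G ` set d"] disj by (metis subset_empty)
    then have "e \<noteq> e'"
      by blast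
    moreover have "e \<in> arcs G" "e' \<in> arcs G"
      using that pre_digraph.cycle_arcs[OF c] pre_digraph.cycle_arcs[OF d] by blast+
    ultimately have "closed_segment (P (tail G e)) (P (head G e))
        \<inter> closed_segment (P (tail G e')) (P (head G e'))
        \<subseteq> P ` ({tail G e, head G e} \<inter> {tail G e', head G e'})"
      using P unfolding straight_drawing_def by blast
    then show ?thesis
      unfolding common by simp
  qed
  then show ?thesis
    unfolding cycle_polygon_def by blast
qed

section \<open>Disjoint cycles in the drawing of the tournament\<close>

lemma straight_drawing_by_place:
  assumes "tournament T" and "inj_on \<iota> (verts T)" and "\<iota> ` verts T \<subseteq> {..<8}"
  shows "straight_drawing T (place \<circ> \<iota>)"
proof -
  interpret loopfree_digraph T
    using assms(1) by (simp add: tournament_def)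
  have less: "\<iota> v < 8" if "v \<in> verts T" for v
    using assms(3) that by auto
  have inj: "\<iota> u = \<iota> v \<longleftrightarrow> u = v" if "u \<in> verts T" "v \<in> verts T" for u v
    using assms(2) that by (auto dest: inj_onD)
  have ends: "\<iota> (tail T e) < 8" "\<iota> (head T e) < 8" "\<iota> (tail T e) \<noteq> \<iota> (head T e)"
    if "e \<in> arcs T" for e
    using that less inj no_loops by auto
  have imI: "\<iota> ` {tail T e, head T e} \<inter> \<iota> ` {tail T e', head T e'}
      = \<iota> ` ({tail T e, head T e} \<inter> {tail T e', head T e'})"
    if "e \<in> arcs T" "e' \<in> arcs T" for e e'
    by (rule inj_on_image_Int[OF assms(2), symmetric]) (use that in auto)
  show ?thesis
    unfolding straight_drawing_def
  proof (intro conjI ballI impI)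
    show "inj_on (place \<circ> \<iota>) (verts T)"
      using assms(2,3) inj_place by (auto intro: comp_inj_on inj_on_subset)
  next
    fix e v assume e: "e \<in> arcs T" and v: "v \<in> verts T"
      and "(place \<circ> \<iota>) v \<in> closed_segment ((place \<circ> \<iota>) (tail T e)) ((place \<circ> \<iota>) (head T e))"
    then have "\<iota> v \<in> {\<iota> (tail T e), \<iota> (head T e)}"
      by (intro place_on_segment ends less) auto
    then show "v \<in> {tail T e, head T e}"
      using e v by (auto simp: inj)
  next
    fix e e' assume e: "e \<in> arcs T" "e' \<in> arcs T" "e \<noteq> e'"
    have "{tail T e, head T e} \<noteq> {tail T e', head T e'}"
      using tournament_arc_eqI[OF assms(1)] e by blast
    then have "{\<iota> (tail T e), \<iota> (head T e)} \<noteq> {\<iota> (tail T e'), \<iota> (head T e')}"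
      using e by (simp add: doubleton_eq_iff inj)
    then have "closed_segment (place (\<iota> (tail T e))) (place (\<iota> (head T e)))
        \<inter> closed_segment (place (\<iota> (tail T e'))) (place (\<iota> (head T e')))
        \<subseteq> place ` (\<iota> ` {tail T e, head T e} \<inter> \<iota> ` {tail T e', head T e'})"
      using place_segments_meet ends e by simp
    then show "closed_segment ((place \<circ> \<iota>) (tail T e)) ((place \<circ> \<iota>) (head T e))
        \<inter> closed_segment ((place \<circ> \<iota>) (tail T e')) ((place \<circ> \<iota>) (head T e'))
        \<subseteq> (place \<circ> \<iota>) ` ({tail T e, head T e} \<inter> {tail T e', head T e'})"
      unfolding imI[OF e(1,2)] by (simp add: image_comp)
  qed
qed

theorem proposition3p5:
  fixes T :: "('a, 'b) pre_digraph"
  assumes "tournament T"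
    and "card (verts T) = 8"
    and "\<exists>U. U \<subseteq> verts T \<and> card U = 4 \<and> (\<Sum>v\<in>U. out_degree T v) = 8"
  shows "\<not> intrinsically_linked_digraph T"
proof -
  interpret fin_digraph T
    using assms(1) by (simp add: tournament_def)
  obtain U where U: "U \<subseteq> verts T" "card U = 4" "(\<Sum>v\<in>U. out_degree T v) = 8"
    using assms(3) by blast
  have "(4 choose 2 :: nat) = 6"
    by (simp add: choose_two)
  then have "card {e \<in> arcs T. tail T e \<in> U \<and> head T e \<notin> U} = 2"
    using tournament_card_leaving_arcs[OF assms(1) U(1)] U(2,3) by simp
  then obtain e1 e2 where leaving: "{e \<in> arcs T. tail T e \<in> U \<and> head T e \<notin> U} = {e1, e2}"
    by (auto simp: card_2_iff)
  then have e1: "tail T e1 \<in> U" "head T e1 \<in> verts T - U"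
    and e2: "tail T e2 \<in> U" "head T e2 \<in> verts T - U"
    using head_in_verts by blast+
  have card_rest: "card (verts T - U) = 4"
    using U assms(2) by (simp add: card_Diff_subset finite_subset)
  obtain a2 x y where U_eq: "U = {tail T e1, a2, x, y}" "distinct [tail T e1, a2, x, y]"
      and a2: "tail T e2 = tail T e1 \<or> tail T e2 = a2"
    using label_four[OF U(2) e1(1) e2(1)] .
  obtain b2 w v where rest_eq: "verts T - U = {head T e1, b2, w, v}" "distinct [head T e1, b2, w, v]"
      and b2: "head T e2 = head T e1 \<or> head T e2 = b2"
    using label_four[OF card_rest e1(2) e2(2)] .
  define a1 where "a1 = tail T e1"
  define b1 where "b1 = head T e1"
  define L where "L = [a1, a2, x, y, b1, b2, w, v]"
  have verts_eq: "verts T = {a1, a2, x, y} \<union> {b1, b2, w, v}"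
    using U(1) U_eq(1) rest_eq(1) unfolding a1_def b1_def by blast
  have distinct_L: "distinct L"
    using U_eq rest_eq unfolding L_def a1_def b1_def by auto
  define \<iota> where "\<iota> = the_inv_into {..<8} ((!) L)"
  have bij: "bij_betw ((!) L) {..<8} (verts T)"
    by (rule bij_betw_nth[OF distinct_L]) (auto simp: L_def verts_eq)
  have \<iota>: "inj_on \<iota> (verts T)" "\<iota> ` verts T \<subseteq> {..<8}"
    using bij_betw_the_inv_into[OF bij] by (simp_all add: \<iota>_def bij_betw_def)
  have \<iota>_nth: "\<iota> (L ! i) = i" if "i < 8" for i
    unfolding \<iota>_def using bij that by (simp add: bij_betw_def the_inv_into_f_f)
  have \<iota>_eqs: "\<iota> a1 = 0" "\<iota> a2 = 1" "\<iota> x = 2" "\<iota> y = 3" "\<iota> b1 = 4" "\<iota> b2 = 5" "\<iota> w = 6" "\<iota> v = 7"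
    using \<iota>_nth[of 0] \<iota>_nth[of 1] \<iota>_nth[of 2] \<iota>_nth[of 3] \<iota>_nth[of 4] \<iota>_nth[of 5] \<iota>_nth[of 6]
      \<iota>_nth[of 7] by (simp_all add: L_def)
  define P where "P = place \<circ> \<iota>"
  have P: "straight_drawing T P"
    unfolding P_def by (rule straight_drawing_by_place[OF assms(1) \<iota>])
  have P2: "P a1 $ 2 = 1" "P a2 $ 2 = 1" "P x $ 2 = 1" "P y $ 2 = 1"
      "P b1 $ 2 = -1" "P b2 $ 2 = -1" "P w $ 2 = -1" "P v $ 2 = -5"
    by (simp_all add: P_def place_coordinates \<iota>_eqs corner_def)
  have P3: "P a1 $ 3 = 1" "P a2 $ 3 = -1" "P x $ 3 = 0" "P y $ 3 = 0"
      "P b1 $ 3 = 1" "P b2 $ 3 = -1" "P w $ 3 = 0" "P v $ 3 = 0"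
    by (simp_all add: P_def place_coordinates \<iota>_eqs corner_def)
  define p :: "real ^ 4" where "p = axis 1 1"
  have p: "p \<in> S3"
    by (simp add: p_def)
  obtain h k where hom: "homeomorphism (S3 - {p}) (UNIV :: (real ^ 3) set) h k"
    using punctured_sphere_homeomorphic_space[OF p] .
  let ?\<gamma> = "\<lambda>e. k \<circ> linepath (P (tail T e)) (P (head T e))"
  have split_by_height: "split_link (cycle_image ?\<gamma> c) (cycle_image ?\<gamma> d)"
    if c: "cycle c" and d: "cycle d" and disj: "tail T ` set c \<inter> tail T ` set d = {}"
      and above: "\<And>u. u \<in> tail T ` set c \<Longrightarrow> m \<le> P u $ i"
      and below: "\<And>u. u \<in> tail T ` set d \<Longrightarrow> P u $ i \<le> m" for c d i m
  proof -
    have "cycle_polygon T P c \<subseteq> {z. m \<le> axis i 1 \<bullet> z}"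
      by (rule cycle_polygon_subset_convex[OF c convex_halfspace_ge])
        (use above in \<open>auto simp: inner_axis'\<close>)
    moreover have "cycle_polygon T P d \<subseteq> {z. axis i 1 \<bullet> z \<le> m}"
      by (rule cycle_polygon_subset_convex[OF d convex_halfspace_le])
        (use below in \<open>auto simp: inner_axis'\<close>)
    ultimately show ?thesis
      unfolding cycle_image_straight
      by (intro split_link_of_weakly_separating_plane[OF hom p, where u = "axis i 1" and c = m]
          compact_cycle_polygon disjoint_cycle_polygons[OF P c d disj]) auto
  qed
  have tails: "u \<in> {a1, a2, x, y, b1, b2, w, v}" if "cycle c" "u \<in> tail T ` set c" for c u
    using that cycle_arcs[of c] tail_in_verts verts_eq by auto
  have e1_ends: "tail T e1 = a1" "head T e1 = b1"
    by (simp_all add: a1_def b1_def)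
  \<comment> \<open>Only the arcs from \<open>a1\<close> to \<open>b1\<close> and \<open>e2\<close> leave \<open>U\<close>, hence a cycle with vertices on both sides uses one of them.\<close>
  have crossing: "a1 \<in> tail T ` set c \<and> b1 \<in> tail T ` set c \<or>
      tail T e2 \<in> tail T ` set c \<and> head T e2 \<in> tail T ` set c"
    if c: "cycle c" and cut: "\<not> tail T ` set c \<subseteq> U" "tail T ` set c \<inter> U \<noteq> {}" for c
  proof -
    obtain e where e: "e \<in> set c" "tail T e \<in> U" "head T e \<notin> U"
      using cycle_crosses_cut[OF c cut] .
    then have "e = e1 \<or> e = e2"
      using leaving cycle_arcs[OF c] by blast
    moreover have "tail T e \<in> tail T ` set c" "head T e \<in> tail T ` set c"
      using e(1) cycle_heads_eq_tails[OF c] by blast+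
    ultimately show ?thesis
      by (auto simp: e1_ends)
  qed
  \<comment> \<open>The plane \<open>q = 1\<close> contains all of \<open>U\<close>, and no vertex is above it.\<close>
  have inside: "split_link (cycle_image ?\<gamma> c) (cycle_image ?\<gamma> d)"
    if "cycle c" "cycle d" "tail T ` set c \<inter> tail T ` set d = {}" "tail T ` set c \<subseteq> U" for c d
  proof (rule split_by_height[of c d 1 2, OF that(1-3)])
    fix u
    show "1 \<le> P u $ 2" if "u \<in> tail T ` set c"
      using that \<open>tail T ` set c \<subseteq> U\<close> P2 U_eq(1) a1_def by auto
    show "P u $ 2 \<le> 1" if "u \<in> tail T ` set d"
      using tails[OF \<open>cycle d\<close> that] P2 by auto
  qed
  \<comment> \<open>No vertex outside \<open>U\<close> is above the plane \<open>q = -1\<close>, and only \<open>v\<close> is below it.\<close>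
  have outside: "split_link (cycle_image ?\<gamma> d) (cycle_image ?\<gamma> c)"
    if "cycle c" "cycle d" "tail T ` set d \<inter> tail T ` set c = {}" "tail T ` set c \<inter> U = {}"
      "v \<notin> tail T ` set d" for c d
  proof (rule split_by_height[of d c "-1" 2, OF that(2,1,3)])
    fix u
    show "-1 \<le> P u $ 2" if "u \<in> tail T ` set d"
      using tails[OF \<open>cycle d\<close> that] that \<open>v \<notin> tail T ` set d\<close> P2 by auto
    show "P u $ 2 \<le> -1" if "u \<in> tail T ` set c"
    proof -
      have "u \<in> {b1, b2, w, v}"
        using tails[OF \<open>cycle c\<close> that] that \<open>tail T ` set c \<inter> U = {}\<close> U_eq(1) a1_def by blast
      then show ?thesis
        using P2 by auto
    qed
  qed
  \<comment> \<open>A crossing cycle that uses \<open>v\<close> would leave only two vertices outside \<open>U\<close> for the other cycle.\<close>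
  have outside_crossing: "split_link (cycle_image ?\<gamma> d) (cycle_image ?\<gamma> c)"
    if c: "cycle c" and d: "cycle d" and disj: "tail T ` set d \<inter> tail T ` set c = {}"
      and c_out: "tail T ` set c \<inter> U = {}"
      and d_cross: "\<not> tail T ` set d \<subseteq> U" "tail T ` set d \<inter> U \<noteq> {}" for c d
  proof (rule outside[OF c d disj c_out], rule notI)
    assume v: "v \<in> tail T ` set d"
    have "b1 \<in> tail T ` set d \<or> b2 \<in> tail T ` set d"
      using crossing[OF d d_cross] b2 unfolding b1_def by auto
    moreover have "tail T ` set c \<subseteq> {b1, b2, w, v}"
      using tails[OF c] c_out U_eq(1) a1_def by blast
    ultimately have "tail T ` set c \<subseteq> {b2, w} \<or> tail T ` set c \<subseteq> {b1, w}"
      using v disj by blast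
    then show False
      using tournament_cycle_not_within_pair[OF assms(1) c] by blast
  qed
  \<comment> \<open>Here the two arcs leaving \<open>U\<close> have no common end, so \<open>e2\<close> does go from \<open>a2\<close> to \<open>b2\<close>. Neither cycle can
    visit the special vertices of the other, so the plane \<open>r = 0\<close> weakly separates them.\<close>
  have both_crossing: "split_link (cycle_image ?\<gamma> c) (cycle_image ?\<gamma> d)"
    if c: "cycle c" and d: "cycle d" and disj: "tail T ` set c \<inter> tail T ` set d = {}"
      and c1: "a1 \<in> tail T ` set c" "b1 \<in> tail T ` set c"
      and d2: "tail T e2 \<in> tail T ` set d" "head T e2 \<in> tail T ` set d" for c d
  proof (rule split_by_height[of c d 0 3, OF c d disj])
    have "a2 \<in> tail T ` set d" "b2 \<in> tail T ` set d"
      using a2 b2 c1 d2 disj unfolding a1_def b1_def by auto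
    then have sub: "tail T ` set c \<subseteq> {a1, b1, x, y, w, v}" "tail T ` set d \<subseteq> {a2, b2, x, y, w, v}"
      using tails[OF c] tails[OF d] c1 disj by blast+
    show "0 \<le> P u $ 3" if "u \<in> tail T ` set c" for u
      using subsetD[OF sub(1) that] P3 by auto
    show "P u $ 3 \<le> 0" if "u \<in> tail T ` set d" for u
      using subsetD[OF sub(2) that] P3 by auto
  qed
  have split: "split_link (cycle_image ?\<gamma> c) (cycle_image ?\<gamma> d)"
    if c: "cycle c" and d: "cycle d" and disj: "tail T ` set c \<inter> tail T ` set d = {}" for c d
  proof -
    have disj': "tail T ` set d \<inter> tail T ` set c = {}"
      using disj by blast
    consider "tail T ` set c \<subseteq> U" | "tail T ` set d \<subseteq> U"
      | "tail T ` set c \<inter> U = {}" "tail T ` set d \<inter> U = {}"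
      | "tail T ` set c \<inter> U = {}" "\<not> tail T ` set d \<subseteq> U" "tail T ` set d \<inter> U \<noteq> {}"
      | "tail T ` set d \<inter> U = {}" "\<not> tail T ` set c \<subseteq> U" "tail T ` set c \<inter> U \<noteq> {}"
      | "\<not> tail T ` set c \<subseteq> U" "tail T ` set c \<inter> U \<noteq> {}"
        "\<not> tail T ` set d \<subseteq> U" "tail T ` set d \<inter> U \<noteq> {}"
      by blast
    then show ?thesis
    proof cases
      case 1
      then show ?thesis
        by (rule inside[OF c d disj])
    next
      case 2
      then show ?thesis
        by (rule split_link_commute[OF inside[OF d c disj']])
    next
      case 3
      then show ?thesis
        using outside[OF c d disj'] split_link_commute outside[OF d c disj] disj by blast
    next
      case 4
      then show ?thesis
        by (rule split_link_commute[OF outside_crossing[OF c d disj']])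
    next
      case 5
      then show ?thesis
        by (rule outside_crossing[OF d c disj])
    next
      case 6
      have "(a1 \<in> tail T ` set c \<and> b1 \<in> tail T ` set c) \<and>
            (tail T e2 \<in> tail T ` set d \<and> head T e2 \<in> tail T ` set d) \<or>
          (a1 \<in> tail T ` set d \<and> b1 \<in> tail T ` set d) \<and>
            (tail T e2 \<in> tail T ` set c \<and> head T e2 \<in> tail T ` set c)"
        using crossing[OF c 6(1,2)] crossing[OF d 6(3,4)] disj by blast
      then show ?thesis
        using both_crossing[OF c d disj] split_link_commute[OF both_crossing[OF d c disj']] by blast
    qed
  qed
  have "tame_embedding_S3 T (k \<circ> P) ?\<gamma>"
    by (rule tame_embedding_of_straight_drawing[OF _ P p hom])
      (use assms(1) in \<open>simp add: tournament_def\<close>)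
  then show ?thesis
    using split unfolding intrinsically_linked_digraph_def by blast
qed

end
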